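(* Let $m,p\ge1$, let $\mu\in\mathrm{Part}(\binom m2;m)$ and $\pi\in\mathrm{Part}(\binom p2;p)$ with $\pi_1\le p+\mu_m$, and put $n=m+p$. Then $$\lambda:=(p+\mu_1,\ldots,p+\mu_m,\pi_1,\ldots,\pi_p)\in\mathrm{Part}\big(\tbinom n2;n\big).$$ Moreover, $\lambda\in\mathcal P(n)$ if and only if $\mu\in\mathcal P(m)$ and $\pi\in\mathcal P(p)$, and we have $$N_\lambda=N_\mu\times N_\pi.$$
   Context: For $r\ge1$, $\mathrm{Part}(\binom r2;r)$ is the set of sequences of nonnegative integers $\lambda=(\lambda_1\ge\cdots\ge\lambda_r)$ with $\lambda_1+\cdots+\lambda_r=\binom r2$, and $\mathcal P(r)$ is the subset of those with $\lambda_1+\cdots+\lambda_i\le(r-1)+\cdots+(r-i)$ for all $i\in\{1,\ldots,r\}$. For $\lambda\in\mathrm{Part}(\binom r2;r)$, $N_\lambda$ is the multiplicity $\mathrm{mult}_{\mathbf S}(\mu[\lambda])$ of the weight $\mu[\lambda]=(\lambda_1-\lambda_2)\varpi_1+\cdots+(\lambda_{r-1}-\lambda_r)\varpi_{r-1}$ in the spin module $\mathbf S$ of $\mathfrak{sl}(r,\mathbb C)$ attached to its diagonal Cartan subalgebra $\mathfrak t$. Here $\epsilon_i\in\mathfrak t^*$ is $\mathrm{diag}(t_1,\ldots,t_r)\mapsto t_i$, $\varpi_i=\epsilon_1+\cdots+\epsilon_i$, $\Phi^+=\{\epsilon_i-\epsilon_j:1\le i<j\le r\}$; $\mathbf S=\bigwedge\big(\bigoplus_{\alpha\in\Phi^+}\mathfrak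 g_\alpha\big)$ with $\mathfrak t$ acting through $\mathrm{ad}:\mathfrak t\to\mathfrak{so}(\mathfrak q)$ ($\mathfrak q$ the Killing-orthogonal complement of $\mathfrak t$) and Clifford multiplication; its weights are $\mu(A)=\frac12\big(\sum_{\alpha\in\Phi^+\setminus A}\alpha-\sum_{\alpha\in A}\alpha\big)$, $A\subset\Phi^+$, and the multiplicity of $\nu\in\mathfrak t^*$ is $\mathrm{mult}_{\mathbf S}(\nu)=\#\{A\subset\Phi^+:\mu(A)=\nu\}$ (zero if $\nu$ is not a weight). *)

theory Defs
  imports
    Complex_Main
    "HOL-Library.Function_Algebras"
    "Jordan_Normal_Form.Matrix"
begin

section \<open>Partitions\<close>

text \<open>A sequence \<open>(xs\<^sub>1, \<dots>, xs\<^sub>r)\<close> is a list of length \<open>r\<close>; note that \<open>xs\<^sub>i\<close> is \<open>xs ! (i - 1)\<close>.\<close>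

definition Part :: "nat \<Rightarrow> nat \<Rightarrow> nat list set" where
  "Part k r = {xs. length xs = r \<and> sorted_wrt (\<ge>) xs \<and> sum_list xs = k}"

definition PP :: "nat \<Rightarrow> nat list set" where
  "PP r = {xs \<in> Part (r choose 2) r.
             \<forall>i\<in>{1..r}. sum_list (take i xs) \<le> (\<Sum>k=1..i. r - k)}"

section \<open>The Lie algebra \<open>sl(r,\<complex>)\<close>\<close>

definition mtrace :: "complex mat \<Rightarrow> complex" where
  "mtrace X = (\<Sum>i<dim_row X. X $$ (i, i))"

definition sl :: "nat \<Rightarrow> complex mat set" where
  "sl r = {X \<in> carrier_mat r r. mtrace X = 0}"

definition cartan :: "nat \<Rightarrow> complex mat set" where
  "cartan r = {H \<in> sl r. diagonal_mat H}"

definition ad :: "complex mat \<Rightarrow> complex mat \<Rightarrow> complex mat" where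
  "ad X Y = X * Y - Y * X"

definition mat_unit :: "nat \<Rightarrow> nat \<times> nat \<Rightarrow> complex mat" where
  "mat_unit r \<alpha> = mat r r (\<lambda>\<beta>. if \<beta> = \<alpha> then 1 else 0)"

text \<open>The trace of \<open>ad X \<circ> ad Y\<close> is computed on all of \<open>gl(r,\<complex>)\<close>, with respect to the basis of
  matrix units. For \<open>X, Y\<close> in \<open>sl(r,\<complex>)\<close> it equals the trace on \<open>sl(r,\<complex>)\<close>, because
  \<open>gl(r,\<complex>)\<close> is the direct sum of \<open>sl(r,\<complex>)\<close> and the scalar matrices, which \<open>ad Y\<close> kills.\<close>

definition killing :: "nat \<Rightarrow> complex mat \<Rightarrow> complex mat \<Rightarrow> complex" where
  "killing r X Y = (\<Sum>\<beta>\<in>{..<r} \<times> {..<r}. ad X (ad Y (mat_unit r \<beta>)) $$ \<beta>)"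

text \<open>The pair \<open>(i, j)\<close> encodes the root \<open>\<epsilon>\<^sub>i - \<epsilon>\<^sub>j\<close> (indices from \<open>0\<close>), with root space
  spanned by \<open>mat_unit r (i, j)\<close>; the pair \<open>prod.swap \<alpha>\<close> encodes the root \<open>-\<alpha>\<close>.
  The matrix units \<open>mat_unit r \<alpha>\<close>, \<open>\<alpha> \<in> roots r\<close>, form a basis of the Killing-orthogonal
  complement \<open>q\<close> of \<open>cartan r\<close> in \<open>sl r\<close>.\<close>

definition roots :: "nat \<Rightarrow> (nat \<times> nat) set" where
  "roots r = {(i, j). i < r \<and> j < r \<and> i \<noteq> j}"

definition pos_roots :: "nat \<Rightarrow> (nat \<times> nat) set" where
  "pos_roots r = {(i, j). i < j \<and> j < r}"

text \<open>The basis of \<open>q\<close> dual to \<open>mat_unit r \<alpha>\<close>, \<open>\<alpha> \<in> roots r\<close>, with respect to the Killing form.\<close>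

definition mat_unit_dual :: "nat \<Rightarrow> nat \<times> nat \<Rightarrow> complex mat" where
  "mat_unit_dual r \<alpha> =
     (1 / killing r (mat_unit r \<alpha>) (mat_unit r (prod.swap \<alpha>))) \<cdot>\<^sub>m mat_unit r (prod.swap \<alpha>)"

text \<open>Linear forms on \<open>cartan r\<close> are represented by functions on matrices; only their
  values on \<open>cartan r\<close> matter.\<close>

definition eps :: "nat \<Rightarrow> complex mat \<Rightarrow> complex" where
  "eps i H = H $$ (i, i)"

definition root_form :: "nat \<times> nat \<Rightarrow> complex mat \<Rightarrow> complex" where
  "root_form \<alpha> H = eps (fst \<alpha>) H - eps (snd \<alpha>) H"

definition fund_weight :: "nat \<Rightarrow> complex mat \<Rightarrow> complex" where
  "fund_weight i H = (\<Sum>j<i. eps j H)"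

section \<open>The spin module\<close>

text \<open>The exterior algebra of the sum of the positive root spaces: \<open>s\<close> stands for
  \<open>\<Sum>A. s A e\<^sub>A\<close> over \<open>A \<subseteq> pos_roots r\<close>, where \<open>e\<^sub>A\<close> is the wedge product of the
  \<open>mat_unit r \<alpha>\<close>, \<open>\<alpha> \<in> A\<close>, in lexicographically increasing order.\<close>

type_synonym spinor = "(nat \<times> nat) set \<Rightarrow> complex"

definition spin_module :: "nat \<Rightarrow> spinor set" where
  "spin_module r = {s. \<forall>A. \<not> A \<subseteq> pos_roots r \<longrightarrow> s A = 0}"

definition spin_scale :: "complex \<Rightarrow> spinor \<Rightarrow> spinor" where
  "spin_scale c s = (\<lambda>A. c * s A)"

definition wedge_sign :: "nat \<times> nat \<Rightarrow> (nat \<times> nat) set \<Rightarrow> complex" where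
  "wedge_sign \<alpha> A = (-1) ^ card {\<beta> \<in> A. fst \<beta> < fst \<alpha> \<or> fst \<beta> = fst \<alpha> \<and> snd \<beta> < snd \<alpha>}"

text \<open>Exterior multiplication by \<open>mat_unit r \<alpha>\<close>, and contraction with the linear form dual to it.\<close>

definition wedge :: "nat \<times> nat \<Rightarrow> spinor \<Rightarrow> spinor" where
  "wedge \<alpha> s = (\<lambda>A. if \<alpha> \<in> A then wedge_sign \<alpha> (A - {\<alpha>}) * s (A - {\<alpha>}) else 0)"

definition contract :: "nat \<times> nat \<Rightarrow> spinor \<Rightarrow> spinor" where
  "contract \<alpha> s = (\<lambda>A. if \<alpha> \<notin> A then wedge_sign \<alpha> A * s (insert \<alpha> A) else 0)"

text \<open>Clifford multiplication by \<open>x \<in> q\<close>: exterior multiplication by the component of \<open>x\<close> in the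
  positive root spaces plus contraction with \<open>2 killing r x\<close>, so that
  \<open>x \<cdot> x \<cdot> s = killing r x x s\<close>.\<close>

definition clifford :: "nat \<Rightarrow> complex mat \<Rightarrow> spinor \<Rightarrow> spinor" where
  "clifford r x s = (\<Sum>\<alpha>\<in>pos_roots r.
     spin_scale (x $$ \<alpha>) (wedge \<alpha> s) + spin_scale (2 * killing r x (mat_unit r \<alpha>)) (contract \<alpha> s))"

text \<open>The action of \<open>T \<in> so(q)\<close> through the embedding of \<open>so(q)\<close> in the Clifford algebra,
  \<open>T \<mapsto> 1/4 \<Sum>\<alpha>. T(e\<^sub>\<alpha>) e\<^sup>\<alpha>\<close> for dual bases \<open>e\<^sub>\<alpha>\<close>, \<open>e\<^sup>\<alpha>\<close> of \<open>q\<close>; its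
  commutator with Clifford multiplication by \<open>x\<close> is Clifford multiplication by \<open>T x\<close>.\<close>

definition spin_rep :: "nat \<Rightarrow> (complex mat \<Rightarrow> complex mat) \<Rightarrow> spinor \<Rightarrow> spinor" where
  "spin_rep r T s = spin_scale (1/4)
     (\<Sum>\<alpha>\<in>roots r. clifford r (T (mat_unit r \<alpha>)) (clifford r (mat_unit_dual r \<alpha>) s))"

definition weight_space :: "nat \<Rightarrow> (complex mat \<Rightarrow> complex) \<Rightarrow> spinor set" where
  "weight_space r \<nu> =
     {s \<in> spin_module r. \<forall>H\<in>cartan r. spin_rep r (ad H) s = spin_scale (\<nu> H) s}"

definition mult_spin :: "nat \<Rightarrow> (complex mat \<Rightarrow> complex) \<Rightarrow> nat" where
  "mult_spin r \<nu> = vector_space.dim spin_scale (weight_space r \<nu>)"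

definition part_weight :: "nat \<Rightarrow> nat list \<Rightarrow> complex mat \<Rightarrow> complex" where
  "part_weight r xs H =
     (\<Sum>i=1..<r. (of_nat (xs ! (i - 1)) - of_nat (xs ! i)) * fund_weight i H)"

definition NN :: "nat \<Rightarrow> nat list \<Rightarrow> nat" where
  "NN r xs = mult_spin r (part_weight r xs)"

text \<open>The weights of the spin module and the combinatorial formula for their multiplicities.
  With the convention above \<open>e\<^sub>A\<close> has weight \<open>- spin_weight r A\<close>, which is
  \<open>spin_weight r (pos_roots r - A)\<close>.\<close>

definition spin_weight :: "nat \<Rightarrow> (nat \<times> nat) set \<Rightarrow> complex mat \<Rightarrow> complex" where
  "spin_weight r A H =
     1/2 * ((\<Sum>\<alpha>\<in>pos_roots r - A. root_form \<alpha> H) - (\<Sum>\<alpha>\<in>A. root_form \<alpha> H))"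

lemma mat_unit_carrier [simp]: "mat_unit r \<alpha> \<in> carrier_mat r r"
  by (simp add: mat_unit_def)

lemma mult_mat_unit_right:
  assumes "A \<in> carrier_mat r r" "k < r" "l < r" "i < r" "j < r"
  shows "(A * mat_unit r (k, l)) $$ (i, j) = (if j = l then A $$ (i, k) else 0)"
proof -
  have "(A * mat_unit r (k, l)) $$ (i, j) = (\<Sum>a<r. A $$ (i, a) * (if a = k \<and> j = l then 1 else 0))"
    using assms by (auto simp: mat_unit_def scalar_prod_def lessThan_atLeast0 intro!: sum.cong)
  also have "\<dots> = (\<Sum>a<r. if a = k then (if j = l then A $$ (i, k) else 0) else 0)"
    by (rule sum.cong) auto
  finally show ?thesis using assms by simp
qed

lemma mult_mat_unit_left:
  assumes "A \<in> carrier_mat r r" "k < r" "l < r" "i < r" "j < r"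
  shows "(mat_unit r (k, l) * A) $$ (i, j) = (if i = k then A $$ (l, j) else 0)"
proof -
  have "(mat_unit r (k, l) * A) $$ (i, j) = (\<Sum>a<r. (if i = k \<and> a = l then 1 else 0) * A $$ (a, j))"
    using assms by (auto simp: mat_unit_def scalar_prod_def lessThan_atLeast0 intro!: sum.cong)
  also have "\<dots> = (\<Sum>a<r. if a = l then (if i = k then A $$ (l, j) else 0) else 0)"
    by (rule sum.cong) auto
  finally show ?thesis using assms by simp
qed

lemma killing_eq:
  assumes X: "X \<in> carrier_mat r r" and Y: "Y \<in> carrier_mat r r"
  shows "killing r X Y = of_nat r * mtrace (X * Y) + of_nat r * mtrace (Y * X)
           - 2 * mtrace X * mtrace Y"
proof -
  have e: "ad X (ad Y (mat_unit r (k, l))) $$ (k, l) =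
      (X * Y) $$ (k, k) - X $$ (k, k) * Y $$ (l, l) - Y $$ (k, k) * X $$ (l, l) + (Y * X) $$ (l, l)"
    if kl: "k < r" "l < r" for k l
  proof -
    let ?Z = "mat_unit r (k, l)"
    have Z: "?Z \<in> carrier_mat r r" by simp
    have "ad X (ad Y ?Z) = (X * (Y * ?Z) - X * (?Z * Y)) - ((Y * ?Z) * X - (?Z * Y) * X)"
      unfolding ad_def using X Y Z mult_minus_distrib_mat[OF X, of "Y * ?Z" r "?Z * Y"]
        minus_mult_distrib_mat[of "Y * ?Z" r r "?Z * Y" X r]
      by (simp only: mult_carrier_mat[of _ r r _ r])
    also have "X * (Y * ?Z) = (X * Y) * ?Z" using X Y Z by (simp add: assoc_mult_mat[of _ r r _ r _ r])
    also have "X * (?Z * Y) = (X * ?Z) * Y" using X Y Z by (simp add: assoc_mult_mat[of _ r r _ r _ r])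
    also have "(?Z * Y) * X = ?Z * (Y * X)" using X Y Z by (simp add: assoc_mult_mat[of _ r r _ r _ r])
    finally have eq: "ad X (ad Y ?Z) = ((X * Y) * ?Z - (X * ?Z) * Y) - ((Y * ?Z) * X - ?Z * (Y * X))" .
    have two: "((A * ?Z) * B) $$ (k, l) = A $$ (k, k) * B $$ (l, l)"
      if A: "A \<in> carrier_mat r r" and B: "B \<in> carrier_mat r r" for A B
    proof -
      have "((A * ?Z) * B) $$ (k, l) = (\<Sum>a<r. (A * ?Z) $$ (k, a) * B $$ (a, l))"
        using A B kl by (auto simp: scalar_prod_def lessThan_atLeast0 mat_unit_def intro!: sum.cong)
      also have "\<dots> = (\<Sum>a<r. if a = l then A $$ (k, k) * B $$ (l, l) else 0)"
        using A kl by (intro sum.cong) (auto simp: mult_mat_unit_right)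
      finally show ?thesis using kl by simp
    qed
    have c: "(X * Y) * ?Z \<in> carrier_mat r r" "(X * ?Z) * Y \<in> carrier_mat r r"
      "(Y * ?Z) * X \<in> carrier_mat r r" "?Z * (Y * X) \<in> carrier_mat r r"
      using X Y Z by (meson mult_carrier_mat)+
    have d: "ad X (ad Y ?Z) $$ (k, l) = (((X * Y) * ?Z) $$ (k, l) - ((X * ?Z) * Y) $$ (k, l))
       - (((Y * ?Z) * X) $$ (k, l) - (?Z * (Y * X)) $$ (k, l))"
      unfolding eq using c kl
      by (metis (no_types, lifting) index_minus_mat(1,2,3) carrier_matD)
    have XY: "X * Y \<in> carrier_mat r r" "Y * X \<in> carrier_mat r r" using X Y by auto
    show ?thesis unfolding d two[OF X Y] two[OF Y X]
      using mult_mat_unit_right[OF XY(1) kl kl] mult_mat_unit_left[OF XY(2) kl kl] by simp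
  qed
  have "killing r X Y = (\<Sum>k<r. \<Sum>l<r. ad X (ad Y (mat_unit r (k, l))) $$ (k, l))"
    unfolding killing_def by (simp add: sum.cartesian_product)
  also have "\<dots> = (\<Sum>k<r. \<Sum>l<r.
      (X * Y) $$ (k, k) - X $$ (k, k) * Y $$ (l, l) - Y $$ (k, k) * X $$ (l, l) + (Y * X) $$ (l, l))"
    by (intro sum.cong refl e) auto
  also have "\<dots> = of_nat r * (\<Sum>k<r. (X * Y) $$ (k, k)) + of_nat r * (\<Sum>k<r. (Y * X) $$ (k, k))
      - 2 * (\<Sum>k<r. X $$ (k, k)) * (\<Sum>k<r. Y $$ (k, k))"
    using sum_product[of "\<lambda>k. X $$ (k, k)" "{..<r}" "\<lambda>k. Y $$ (k, k)" "{..<r}"]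
      sum_product[of "\<lambda>k. Y $$ (k, k)" "{..<r}" "\<lambda>k. X $$ (k, k)" "{..<r}"]
    by (simp add: sum.distrib sum_subtractf mult.commute flip: sum_distrib_left)
  finally show ?thesis using X Y by (simp add: mtrace_def)
qed

lemma killing_smult:
  assumes "X \<in> carrier_mat r r" "Y \<in> carrier_mat r r"
  shows "killing r (c \<cdot>\<^sub>m X) Y = c * killing r X Y"
proof -
  have a: "mtrace (c \<cdot>\<^sub>m Z) = c * mtrace Z" if "Z \<in> carrier_mat r r" for Z
    using that by (simp add: mtrace_def sum_distrib_left)
  show ?thesis using assms
    by (simp add: killing_eq a mult_smult_assoc_mat[of _ r r _ r] mult_smult_distrib[of _ r r _ r]
        algebra_simps)
qed

lemma mtrace_mat_unit_mult:
  assumes "i < r" "j < r" "k < r" "l < r"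
  shows "mtrace (mat_unit r (i, j) * mat_unit r (k, l)) = (if i = l \<and> j = k then 1 else 0)"
proof -
  have "mtrace (mat_unit r (i, j) * mat_unit r (k, l)) =
      (\<Sum>a<r. (mat_unit r (i, j) * mat_unit r (k, l)) $$ (a, a))"
    by (simp add: mtrace_def mat_unit_def)
  also have "\<dots> = (\<Sum>a<r. if a = l then (if i = l \<and> j = k then 1 else 0) else 0)"
    using assms by (intro sum.cong) (auto simp: mult_mat_unit_right, auto simp: mat_unit_def)
  finally show ?thesis using assms by simp
qed

lemma killing_mat_unit:
  assumes "\<alpha> \<in> roots r" "\<beta> \<in> roots r"
  shows "killing r (mat_unit r \<alpha>) (mat_unit r \<beta>) = (if \<alpha> = prod.swap \<beta> then 2 * of_nat r else 0)"
proof -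
  obtain i j k l where ij: "\<alpha> = (i, j)" "\<beta> = (k, l)" by fastforce
  have "mtrace (mat_unit r \<alpha>) = 0"
    using assms ij by (auto simp: mtrace_def mat_unit_def roots_def intro!: sum.neutral)
  then show ?thesis using assms ij
    by (auto simp: killing_eq roots_def mtrace_mat_unit_mult)
qed

lemma finite_pos_roots [simp]: "finite (pos_roots r)"
  by (rule finite_subset[of _ "{..<r} \<times> {..<r}"]) (auto simp: pos_roots_def)

lemma roots_eq: "roots r = pos_roots r \<union> prod.swap ` pos_roots r"
  by (auto simp: roots_def pos_roots_def image_iff)

lemma roots_disjoint: "pos_roots r \<inter> prod.swap ` pos_roots r = {}"
  by (auto simp: pos_roots_def)

lemma sum_fun_apply: "(\<Sum>x\<in>A. f x) y = (\<Sum>x\<in>A. f x y)"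
  by (induction A rule: infinite_finite_induct) auto

lemma clifford_apply:
  "clifford r x s A = (\<Sum>\<alpha>\<in>pos_roots r.
     x $$ \<alpha> * wedge \<alpha> s A + 2 * killing r x (mat_unit r \<alpha>) * contract \<alpha> s A)"
  by (simp add: clifford_def sum_fun_apply spin_scale_def)

lemma clifford_pos:
  assumes "\<beta> \<in> pos_roots r"
  shows "clifford r (c \<cdot>\<^sub>m mat_unit r \<beta>) s = spin_scale c (wedge \<beta> s)"
proof
  fix A
  have b: "\<beta> \<in> roots r" using assms by (simp add: roots_eq)
  have "clifford r (c \<cdot>\<^sub>m mat_unit r \<beta>) s A =
      (\<Sum>\<alpha>\<in>pos_roots r. if \<alpha> = \<beta> then c * wedge \<beta> s A else 0)"
    unfolding clifford_apply
  proof (intro sum.cong refl)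
    fix \<alpha> assume a: "\<alpha> \<in> pos_roots r"
    have "\<beta> \<noteq> prod.swap \<alpha>" using a assms roots_disjoint by blast
    moreover have "(c \<cdot>\<^sub>m mat_unit r \<beta>) $$ \<alpha> = (if \<alpha> = \<beta> then c else 0)"
      using a by (auto simp: mat_unit_def pos_roots_def)
    ultimately show "(c \<cdot>\<^sub>m mat_unit r \<beta>) $$ \<alpha> * wedge \<alpha> s A
        + 2 * killing r (c \<cdot>\<^sub>m mat_unit r \<beta>) (mat_unit r \<alpha>) * contract \<alpha> s A
        = (if \<alpha> = \<beta> then c * wedge \<beta> s A else 0)"
      using a b by (simp add: killing_smult killing_mat_unit roots_eq)
  qed
  also have "\<dots> = spin_scale c (wedge \<beta> s) A" using assms by (simp add: spin_scale_def)
  finally show "clifford r (c \<cdot>\<^sub>m mat_unit r \<beta>) s A = spin_scale c (wedge \<beta> s) A" .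
qed

lemma clifford_neg:
  assumes "\<beta> \<in> pos_roots r"
  shows "clifford r (c \<cdot>\<^sub>m mat_unit r (prod.swap \<beta>)) s
      = spin_scale (4 * of_nat r * c) (contract \<beta> s)"
proof
  fix A
  have b: "prod.swap \<beta> \<in> roots r" using assms by (simp add: roots_eq)
  have "clifford r (c \<cdot>\<^sub>m mat_unit r (prod.swap \<beta>)) s A =
      (\<Sum>\<alpha>\<in>pos_roots r. if \<alpha> = \<beta> then 4 * of_nat r * c * contract \<beta> s A else 0)"
    unfolding clifford_apply
  proof (intro sum.cong refl)
    fix \<alpha> assume a: "\<alpha> \<in> pos_roots r"
    have "\<alpha> \<noteq> prod.swap \<beta>" using a assms roots_disjoint by blast
    then have "(c \<cdot>\<^sub>m mat_unit r (prod.swap \<beta>)) $$ \<alpha> = 0"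
      using a by (auto simp: mat_unit_def pos_roots_def)
    moreover have "prod.swap \<beta> = prod.swap \<alpha> \<longleftrightarrow> \<alpha> = \<beta>" by (auto simp: prod_eq_iff)
    ultimately show "(c \<cdot>\<^sub>m mat_unit r (prod.swap \<beta>)) $$ \<alpha> * wedge \<alpha> s A
        + 2 * killing r (c \<cdot>\<^sub>m mat_unit r (prod.swap \<beta>)) (mat_unit r \<alpha>) * contract \<alpha> s A
        = (if \<alpha> = \<beta> then 4 * of_nat r * c * contract \<beta> s A else 0)"
      using a b by (simp add: killing_smult killing_mat_unit roots_eq)
  qed
  also have "\<dots> = spin_scale (4 * of_nat r * c) (contract \<beta> s) A"
    using assms by (simp add: spin_scale_def)
  finally show "clifford r (c \<cdot>\<^sub>m mat_unit r (prod.swap \<beta>)) s A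
      = spin_scale (4 * of_nat r * c) (contract \<beta> s) A" .
qed

lemma ad_mat_unit:
  assumes "H \<in> cartan r" "\<alpha> \<in> roots r"
  shows "ad H (mat_unit r \<alpha>) = root_form \<alpha> H \<cdot>\<^sub>m mat_unit r \<alpha>"
proof -
  obtain i j where ij: "\<alpha> = (i, j)" by fastforce
  have H: "H \<in> carrier_mat r r" and diag: "\<And>a b. a < r \<Longrightarrow> b < r \<Longrightarrow> a \<noteq> b \<Longrightarrow> H $$ (a, b) = 0"
    using assms by (auto simp: cartan_def sl_def diagonal_mat_def)
  have l: "i < r" "j < r" using assms ij by (auto simp: roots_def)
  have c: "H * mat_unit r (i, j) \<in> carrier_mat r r" "mat_unit r (i, j) * H \<in> carrier_mat r r"
    using H by (auto simp: mat_unit_def)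
  show ?thesis unfolding ad_def ij
  proof (rule eq_matI)
    fix a b assume "a < dim_row (root_form (i, j) H \<cdot>\<^sub>m mat_unit r (i, j))"
      "b < dim_col (root_form (i, j) H \<cdot>\<^sub>m mat_unit r (i, j))"
    then have ab: "a < r" "b < r" by (auto simp: mat_unit_def)
    have "(H * mat_unit r (i, j) - mat_unit r (i, j) * H) $$ (a, b) =
        (H * mat_unit r (i, j)) $$ (a, b) - (mat_unit r (i, j) * H) $$ (a, b)"
      using c ab by (metis carrier_matD index_minus_mat(1))
    then show "(H * mat_unit r (i, j) - mat_unit r (i, j) * H) $$ (a, b) =
        (root_form (i, j) H \<cdot>\<^sub>m mat_unit r (i, j)) $$ (a, b)"
      unfolding mult_mat_unit_left[OF H l ab] mult_mat_unit_right[OF H l ab]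
      using ab l diag by (auto simp: mat_unit_def root_form_def eps_def)
  qed (use H in \<open>auto simp: mat_unit_def\<close>)
qed

lemma wedge_sign_square: "wedge_sign \<alpha> A * (wedge_sign \<alpha> A * x) = x"
  by (simp add: wedge_sign_def flip: mult.assoc power_add)

lemma wedge_contract: "wedge \<alpha> (contract \<alpha> s) A = (if \<alpha> \<in> A then s A else 0)"
  by (simp add: wedge_def contract_def wedge_sign_square insert_absorb)

lemma contract_wedge: "contract \<alpha> (wedge \<alpha> s) A = (if \<alpha> \<in> A then 0 else s A)"
  by (simp add: wedge_def contract_def wedge_sign_square)

lemma wedge_scale: "wedge \<alpha> (spin_scale c s) A = c * wedge \<alpha> s A"
  by (simp add: wedge_def spin_scale_def)

lemma contract_scale: "contract \<alpha> (spin_scale c s) A = c * contract \<alpha> s A"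
  by (simp add: contract_def spin_scale_def)

lemma spin_rep_ad:
  assumes H: "H \<in> cartan r" and A: "A \<subseteq> pos_roots r"
  shows "spin_rep r (ad H) s A = - spin_weight r A H * s A"
proof -
  let ?f = "\<lambda>\<alpha>. clifford r (ad H (mat_unit r \<alpha>)) (clifford r (mat_unit_dual r \<alpha>) s) A"
  have r0: "(of_nat r :: complex) \<noteq> 0" if "\<alpha> \<in> pos_roots r" for \<alpha>
    using that by (auto simp: pos_roots_def)
  have p: "?f \<alpha> = 2 * root_form \<alpha> H * (if \<alpha> \<in> A then s A else 0)" if a: "\<alpha> \<in> pos_roots r" for \<alpha>
  proof -
    have r: "\<alpha> \<in> roots r" "prod.swap \<alpha> \<in> roots r" using a by (auto simp: roots_eq)
    show ?thesis using r0[OF a] unfolding ad_mat_unit[OF H r(1)] clifford_pos[OF a] mat_unit_dual_def clifford_neg[OF a]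
      by (simp add: killing_mat_unit[OF r] spin_scale_def[of "root_form \<alpha> H"] wedge_scale wedge_contract)
  qed
  have n: "?f (prod.swap \<alpha>) = - 2 * root_form \<alpha> H * (if \<alpha> \<in> A then 0 else s A)"
    if a: "\<alpha> \<in> pos_roots r" for \<alpha>
  proof -
    have r: "\<alpha> \<in> roots r" "prod.swap \<alpha> \<in> roots r" using a by (auto simp: roots_eq)
    have "mat_unit_dual r (prod.swap \<alpha>) = (1 / (2 * of_nat r)) \<cdot>\<^sub>m mat_unit r \<alpha>"
      unfolding mat_unit_dual_def using killing_mat_unit[OF r(2,1)] by simp
    moreover have "root_form (prod.swap \<alpha>) H = - root_form \<alpha> H" by (simp add: root_form_def)
    ultimately show ?thesis using r0[OF a]
      by (simp add: ad_mat_unit[OF H r(2)] clifford_pos[OF a] clifford_neg[OF a] contract_scale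
          contract_wedge spin_scale_def[of "- (4 * _ * _)"])
  qed
  have "spin_rep r (ad H) s A = 1/4 * (\<Sum>\<alpha>\<in>roots r. ?f \<alpha>)"
    by (simp add: spin_rep_def spin_scale_def[of "1/4"] sum_fun_apply)
  also have "(\<Sum>\<alpha>\<in>roots r. ?f \<alpha>) = (\<Sum>\<alpha>\<in>pos_roots r. ?f \<alpha>) + (\<Sum>\<alpha>\<in>pos_roots r. ?f (prod.swap \<alpha>))"
    unfolding roots_eq using roots_disjoint
    by (subst sum.union_disjoint) (auto simp: sum.reindex)
  also have "\<dots> = (\<Sum>\<alpha>\<in>pos_roots r. if \<alpha> \<in> A then 2 * root_form \<alpha> H * s A else - 2 * root_form \<alpha> H * s A)"
    by (simp only: sum.distrib[symmetric], intro sum.cong refl, simp only: p n) auto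
  also have "\<dots> = (\<Sum>\<alpha>\<in>A. 2 * root_form \<alpha> H * s A) + (\<Sum>\<alpha>\<in>pos_roots r - A. - 2 * root_form \<alpha> H * s A)"
    using A by (subst sum.subset_diff[OF A]) (auto simp: add.commute intro!: arg_cong2[of _ _ _ _ "(+)"] sum.cong)
  also have "\<dots> = 2 * s A * ((\<Sum>\<alpha>\<in>A. root_form \<alpha> H) - (\<Sum>\<alpha>\<in>pos_roots r - A. root_form \<alpha> H))"
    by (simp add: sum_distrib_left algebra_simps sum_negf)
  finally show ?thesis by (simp add: spin_weight_def algebra_simps)
qed

lemma wedge_spin_module: "\<alpha> \<in> pos_roots r \<Longrightarrow> s \<in> spin_module r \<Longrightarrow> wedge \<alpha> s \<in> spin_module r"
  unfolding spin_module_def wedge_def by simp (metis Diff_subset_conv insert_absorb insert_is_Un)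

lemma contract_spin_module: "s \<in> spin_module r \<Longrightarrow> contract \<alpha> s \<in> spin_module r"
  by (auto simp: contract_def spin_module_def)

lemma clifford_spin_module:
  assumes "s \<in> spin_module r"
  shows "clifford r x s \<in> spin_module r"
  using wedge_spin_module[OF _ assms] contract_spin_module[OF assms]
  by (auto simp: spin_module_def clifford_apply intro!: sum.neutral)

lemma spin_rep_spin_module: "s \<in> spin_module r \<Longrightarrow> spin_rep r T s \<in> spin_module r"
  using clifford_spin_module[OF clifford_spin_module, of s r]
  by (auto simp: spin_module_def spin_rep_def spin_scale_def sum_fun_apply intro!: sum.neutral)

lemma vector_space_spin_scale: "vector_space spin_scale"
  by unfold_locales (auto simp: spin_scale_def algebra_simps)

interpretation spin: vector_space spin_scale
  by (rule vector_space_spin_scale)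

definition spin_basis :: "(nat \<times> nat) set \<Rightarrow> spinor" where
  "spin_basis A = (\<lambda>B. if B = A then 1 else 0)"

lemma dim_supported:
  assumes W: "finite W"
  shows "spin.dim {s. \<forall>A. A \<notin> W \<longrightarrow> s A = 0} = card W"
proof (rule spin.dim_unique)
  have inj: "inj spin_basis" by (auto simp: inj_def spin_basis_def fun_eq_iff)
  have at: "(\<Sum>A\<in>W. spin_scale (c A) (spin_basis A)) B = (if B \<in> W then c B else 0)" for c B
    using W by (simp add: sum_fun_apply spin_scale_def spin_basis_def if_distrib cong: if_cong)
  show "spin_basis ` W \<subseteq> {s. \<forall>A. A \<notin> W \<longrightarrow> s A = 0}" by (auto simp: spin_basis_def)
  show "{s. \<forall>A. A \<notin> W \<longrightarrow> s A = 0} \<subseteq> spin.span (spin_basis ` W)"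
  proof
    fix s :: spinor assume "s \<in> {s. \<forall>A. A \<notin> W \<longrightarrow> s A = 0}"
    then have "s = (\<Sum>A\<in>W. spin_scale (s A) (spin_basis A))" by (auto simp: fun_eq_iff at)
    then show "s \<in> spin.span (spin_basis ` W)"
      by (metis (mono_tags, lifting) imageI spin.span_base spin.span_scale spin.span_sum)
  qed
  show "spin.independent (spin_basis ` W)"
  proof (rule spin.independent_if_scalars_zero)
    show "finite (spin_basis ` W)" using W by simp
    fix f x assume z: "(\<Sum>x\<in>spin_basis ` W. spin_scale (f x) x) = 0" and x: "x \<in> spin_basis ` W"
    obtain B where B: "B \<in> W" "x = spin_basis B" using x by auto
    have "(\<Sum>A\<in>W. spin_scale (f (spin_basis A)) (spin_basis A)) = 0"
      using z by (subst (asm) sum.reindex) (auto intro: inj_on_subset[OF inj])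
    then show "f x = 0" using at[of "\<lambda>A. f (spin_basis A)" B] B by simp
  qed
  show "card (spin_basis ` W) = card W" by (intro card_image inj_on_subset[OF inj]) auto
qed

theorem mult_spin_eq_card:
  "mult_spin r \<nu> =
     card {A. A \<subseteq> pos_roots r \<and> (\<forall>H\<in>cartan r. spin_weight r A H = \<nu> H)}" (is "_ = card ?V")
proof -
  let ?W = "{A. A \<subseteq> pos_roots r \<and> (\<forall>H\<in>cartan r. - spin_weight r A H = \<nu> H)}"
  have fin: "finite ?W" by (rule finite_subset[of _ "Pow (pos_roots r)"]) auto
  have "weight_space r \<nu> = {s. \<forall>A. A \<notin> ?W \<longrightarrow> s A = 0}" (is "_ = ?R")
  proof (rule equalityI; rule subsetI)
    fix s assume s: "s \<in> weight_space r \<nu>"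
    show "s \<in> ?R"
    proof (intro CollectI allI impI)
      fix A assume A: "A \<notin> ?W"
      show "s A = 0"
      proof (cases "A \<subseteq> pos_roots r")
        case False then show ?thesis using s by (auto simp: weight_space_def spin_module_def)
      next
        case True
        then obtain H where H: "H \<in> cartan r" "- spin_weight r A H \<noteq> \<nu> H" using A by auto
        have "spin_rep r (ad H) s = spin_scale (\<nu> H) s"
          using s H(1) by (simp add: weight_space_def)
        then have "- spin_weight r A H * s A = \<nu> H * s A"
          using spin_rep_ad[OF H(1) True, of s] by (simp add: spin_scale_def)
        then show ?thesis using H(2) by (metis mult_cancel_right)
      qed
    qed
  next
    fix s assume s: "s \<in> ?R"
    then have sm: "s \<in> spin_module r" by (auto simp: spin_module_def)
    have "spin_rep r (ad H) s A = spin_scale (\<nu> H) s A" if H: "H \<in> cartan r" for H A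
    proof (cases "A \<subseteq> pos_roots r")
      case False
      then show ?thesis using sm spin_rep_spin_module[OF sm]
        by (auto simp: spin_module_def spin_scale_def)
    next
      case True
      show ?thesis
      proof (cases "A \<in> ?W")
        case False
        then have "s A = 0" using s by blast
        then show ?thesis using spin_rep_ad[OF H True, of s] by (simp add: spin_scale_def)
      next
        case in_W: True
        then have "- spin_weight r A H = \<nu> H" using H by blast
        then show ?thesis using spin_rep_ad[OF H True, of s] by (simp add: spin_scale_def)
      qed
    qed
    then show "s \<in> weight_space r \<nu>" using sm by (auto simp: weight_space_def)
  qed
  then have "mult_spin r \<nu> = card ?W" using dim_supported[OF fin] unfolding mult_spin_def by simp
  also have "\<dots> = card ?V"
  proof (rule bij_betw_same_card[of "\<lambda>A. pos_roots r - A"], rule bij_betw_byWitness[of _ "\<lambda>A. pos_roots r - A"])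
    have c: "spin_weight r (pos_roots r - A) H = - spin_weight r A H" if "A \<subseteq> pos_roots r" for A H
      using that by (simp add: spin_weight_def double_diff field_simps)
    show "(\<lambda>A. pos_roots r - A) ` ?W \<subseteq> ?V" using c by auto
    show "(\<lambda>A. pos_roots r - A) ` ?V \<subseteq> ?W" using c by auto
  qed auto
  finally show ?thesis .
qed

end

theory Submission
  imports Defs
begin

text \<open>A subset \<open>A\<close> of \<open>\<Phi>\<^sup>+\<close> is a tournament on \<open>{0, \<dots>, r - 1}\<close>: the pair \<open>i < j\<close> is won by \<open>i\<close>
  if it is not in \<open>A\<close>, and by \<open>j\<close> otherwise. Up to a multiple of the trace the weight of \<open>A\<close> is the
  score sequence, so \<open>N\<^sub>\<lambda>\<close> counts the tournaments with score sequence \<open>\<lambda>\<close>. If the first \<open>m\<close> of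
  \<open>m + p\<close> players score \<open>m p + (m choose 2)\<close> in total, then they win all their games against the
  last \<open>p\<close> players, so the tournament splits into a tournament on each of the two groups.\<close>

section \<open>Scores\<close>

definition score :: "nat \<Rightarrow> (nat \<times> nat) set \<Rightarrow> nat \<Rightarrow> nat" where
  "score r A i = card {j. (i, j) \<in> pos_roots r - A} + card {j. (j, i) \<in> A}"

definition tournaments :: "nat \<Rightarrow> nat list \<Rightarrow> (nat \<times> nat) set set" where
  "tournaments r xs = {A. A \<subseteq> pos_roots r \<and> (\<forall>i<r. score r A i = xs ! i)}"

text \<open>Pairs are grouped by their first entry. With \<open>f\<close> constant \<open>1\<close>
  this counts wins; with \<open>f\<close> the coordinate \<open>eps\<close> it collects a sum of
  roots by coordinates.\<close>

lemma sum_fst: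
  fixes f :: "nat \<Rightarrow> 'a::comm_semiring_1"
  assumes "finite X" and "fst ` X \<subseteq> I" and "finite I"
  shows "(\<Sum>\<alpha>\<in>X. f (fst \<alpha>)) = (\<Sum>i\<in>I. of_nat (card {j. (i, j) \<in> X}) * f i)"
proof -
  have fin: "finite {j. (i, j) \<in> X}" for i
    by (rule finite_subset[of _ "snd ` X"]) (use assms(1) in \<open>force+\<close>)
  have "X = Sigma I (\<lambda>i. {j. (i, j) \<in> X})" using assms(2) by force
  then have "(\<Sum>\<alpha>\<in>X. f (fst \<alpha>)) = (\<Sum>(i, j)\<in>Sigma I (\<lambda>i. {j. (i, j) \<in> X}). f i)"
    by (simp add: case_prod_beta)
  then show ?thesis using fin assms(3) by (simp add: sum.Sigma[symmetric])
qed

lemma sum_snd: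
  fixes f :: "nat \<Rightarrow> 'a::comm_semiring_1"
  assumes "finite X" and "snd ` X \<subseteq> I" and "finite I"
  shows "(\<Sum>\<alpha>\<in>X. f (snd \<alpha>)) = (\<Sum>i\<in>I. of_nat (card {j. (j, i) \<in> X}) * f i)"
proof -
  have "(\<Sum>\<alpha>\<in>X. f (snd \<alpha>)) = (\<Sum>\<alpha>\<in>prod.swap ` X. f (fst \<alpha>))"
    by (simp add: sum.reindex)
  also have "\<dots> = (\<Sum>i\<in>I. of_nat (card {j. (i, j) \<in> prod.swap ` X}) * f i)"
    using assms by (intro sum_fst) auto
  also have "\<dots> = (\<Sum>i\<in>I. of_nat (card {j. (j, i) \<in> X}) * f i)"
    by (intro sum.cong refl arg_cong2[of _ _ _ _ "(*)"] arg_cong[of _ _ "\<lambda>Y. of_nat (card Y)"]) force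
  finally show ?thesis .
qed

lemma card_pos_roots: "card (pos_roots r) = r choose 2"
proof -
  have "snd ` pos_roots r \<subseteq> {..<r}" by (auto simp: pos_roots_def)
  then have "card (pos_roots r) = (\<Sum>i<r. card {j. (j, i) \<in> pos_roots r})"
    using sum_snd[of "pos_roots r" "{..<r}" "\<lambda>_. 1::nat"] by simp
  also have "\<dots> = (\<Sum>i<r. i)"
    by (intro sum.cong) (auto simp: pos_roots_def cong: conj_cong)
  finally show ?thesis by (simp add: choose_two Sum_Ico_nat[of 0] lessThan_atLeast0)
qed

lemma choose_two_add: "(m + p) choose 2 = (m choose 2) + (p choose 2) + m * p"
  by (induction p) (auto simp: numeral_2_eq_2)

text \<open>Each of the \<open>m choose 2\<close> games among the first \<open>m\<close> players
  contributes one win to their total; beyond that they win exactly the cross games that are not in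
  \<open>A\<close>.\<close>

lemma sum_score:
  assumes "m \<le> r" and A: "A \<subseteq> pos_roots r"
  shows "(\<Sum>i<m. score r A i) = (m choose 2) + card ({..<m} \<times> {m..<r} - A)"
proof -
  \<comment> \<open>These are the games won by one of the first \<open>m\<close> players, as the
    smaller and as the larger index respectively.\<close>
  let ?W = "{\<alpha> \<in> pos_roots r - A. fst \<alpha> < m}" and ?L = "{\<alpha> \<in> A. snd \<alpha> < m}"
  have fA: "finite A" using A finite_subset by fastforce
  have 1: "card ?W = (\<Sum>i<m. card {j. (i, j) \<in> pos_roots r - A})"
    using sum_fst[of ?W "{..<m}" "\<lambda>_. 1::nat"] by auto
  have 2: "card ?L = (\<Sum>i<m. card {j. (j, i) \<in> A})"
    using sum_snd[of ?L "{..<m}" "\<lambda>_. 1::nat"] fA by auto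
  have W: "?W = (pos_roots m - A) \<union> ({..<m} \<times> {m..<r} - A)"
    using assms by (auto simp: pos_roots_def)
  have L: "?L = pos_roots m \<inter> A" using assms by (auto simp: pos_roots_def)
  have "card ?W = card (pos_roots m - A) + card ({..<m} \<times> {m..<r} - A)"
    unfolding W by (rule card_Un_disjoint) (simp, simp, auto simp: pos_roots_def)
  moreover have "card (pos_roots m) = card (pos_roots m \<inter> A) + card (pos_roots m - A)"
    by (rule card_Int_Diff) simp
  ultimately show ?thesis
    using L 1 2 by (simp add: score_def sum.distrib card_pos_roots)
qed

lemma sum_score_all: "A \<subseteq> pos_roots r \<Longrightarrow> (\<Sum>i<r. score r A i) = r choose 2"
  using sum_score[of r r A] by simp

section \<open>Weights as score sequences\<close>

lemma cartan_trace:
  assumes "H \<in> cartan r"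
  shows "(\<Sum>i<r. eps i H) = 0"
  using assms by (auto simp: cartan_def sl_def mtrace_def eps_def)

text \<open>The weight is half of wins minus losses, coordinate by coordinate. Wins plus losses is
  \<open>r - 1\<close> for every player, hence a multiple of the trace, which vanishes on the Cartan
  subalgebra; so half the difference equals the wins.\<close>

lemma spin_weight_eq_score:
  assumes A: "A \<subseteq> pos_roots r" and H: "H \<in> cartan r"
  shows "spin_weight r A H = (\<Sum>i<r. of_nat (score r A i) * eps i H)"
proof -
  let ?P = "pos_roots r"
  let ?f = "\<lambda>X. \<Sum>\<alpha>\<in>X. eps (fst \<alpha>) H" and ?s = "\<lambda>X. \<Sum>\<alpha>\<in>X. eps (snd \<alpha>) H"
  have fA: "finite A" using A finite_subset by fastforce
  have sub: "fst ` ?P \<subseteq> {..<r}" "snd ` ?P \<subseteq> {..<r}" by (auto simp: pos_roots_def)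
  have "?f ?P + ?s ?P =
      (\<Sum>i<r. of_nat (card {j. (i, j) \<in> ?P} + card {j. (j, i) \<in> ?P}) * eps i H)"
    using sub by (simp add: sum_fst[of _ "{..<r}" "\<lambda>i. eps i H"]
        sum_snd[of _ "{..<r}" "\<lambda>i. eps i H"] sum.distrib algebra_simps)
  also have "\<dots> = (\<Sum>i<r. of_nat (r - 1) * eps i H)"
  proof (intro sum.cong refl arg_cong2[of _ _ _ _ "(*)"] arg_cong[of _ _ of_nat])
    fix i assume "i \<in> {..<r}"
    moreover from this have "{j. (i, j) \<in> ?P} = {i<..<r}" "{j. (j, i) \<in> ?P} = {..<i}"
      by (auto simp: pos_roots_def)
    ultimately show "card {j. (i, j) \<in> ?P} + card {j. (j, i) \<in> ?P} = r - 1" by simp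
  qed
  finally have "?f ?P + ?s ?P = 0"
    using cartan_trace[OF H] by (simp flip: sum_distrib_left)
  moreover have "?f ?P = ?f (?P - A) + ?f A" "?s ?P = ?s (?P - A) + ?s A"
    using A by (simp_all add: sum.subset_diff)
  moreover have "?f (?P - A) + ?s A = (\<Sum>i<r. of_nat (score r A i) * eps i H)"
  proof -
    have "fst ` (?P - A) \<subseteq> {..<r}" "snd ` A \<subseteq> {..<r}" using sub A by fast+
    then show ?thesis
      using fA by (simp add: sum_fst[of _ "{..<r}" "\<lambda>i. eps i H"]
          sum_snd[of _ "{..<r}" "\<lambda>i. eps i H"] score_def sum.distrib algebra_simps)
  qed
  moreover have "(?f (?P - A) - ?s (?P - A)) - (?f A - ?s A) = 2 * (?f (?P - A) + ?s A)
      - ((?f (?P - A) + ?f A) + (?s (?P - A) + ?s A))"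
    by (simp add: algebra_simps)
  ultimately have "(?f (?P - A) - ?s (?P - A)) - (?f A - ?s A) =
      2 * (\<Sum>i<r. of_nat (score r A i) * eps i H)"
    by simp
  then show ?thesis
    by (simp add: spin_weight_def root_form_def sum_subtractf)
qed

lemma fund_weight_Suc: "fund_weight (Suc i) H = fund_weight i H + eps i H"
  by (simp add: fund_weight_def)

text \<open>Summation by parts.\<close>

lemma part_weight_eq:
  assumes "1 \<le> r" and H: "H \<in> cartan r"
  shows "part_weight r xs H = (\<Sum>i<r. of_nat (xs ! i) * eps i H)"
proof -
  \<comment> \<open>The induction carries the boundary term along; for \<open>k = r - 1\<close> it
    contains \<open>fund_weight r H\<close>, which is the trace of \<open>H\<close> and hence
    zero.\<close>
  have "part_weight (Suc k) xs H =
      (\<Sum>i<Suc k. of_nat (xs ! i) * eps i H) - of_nat (xs ! k) * fund_weight (Suc k) H" for k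
  proof (induction k)
    case 0
    then show ?case by (simp add: part_weight_def fund_weight_def)
  next
    case (Suc k)
    have "part_weight (Suc (Suc k)) xs H = part_weight (Suc k) xs H +
        (of_nat (xs ! k) - of_nat (xs ! Suc k)) * fund_weight (Suc k) H"
      by (simp add: part_weight_def)
    then show ?case using Suc by (simp add: fund_weight_Suc algebra_simps)
  qed
  from this[of "r - 1"] show ?thesis
    using assms cartan_trace[OF H] by (simp add: fund_weight_def)
qed

text \<open>For \<open>i \<noteq> j\<close> this is the coroot of the root with index pair
  \<open>(i, j)\<close>. Evaluating a linear form there yields the difference of two of its
  coefficients.\<close>

definition coroot :: "nat \<Rightarrow> nat \<Rightarrow> nat \<Rightarrow> complex mat" where
  "coroot r i j = mat r r (\<lambda>(a, b). if a = b then (if a = i then 1 else if a = j then -1 else 0) else 0)"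

lemma sum_coroot:
  assumes "i < r" "j < r" "i \<noteq> j"
  shows "(\<Sum>a<r. f a * eps a (coroot r i j)) = f i - f j"
proof -
  have "(\<Sum>a<r. f a * eps a (coroot r i j)) =
      (\<Sum>a<r. (if a = i then f i else 0) + (if a = j then - f j else 0))"
    using assms by (intro sum.cong) (auto simp: eps_def coroot_def)
  then show ?thesis using assms by (simp add: sum.distrib)
qed

lemma coroot_cartan:
  assumes "i < r" "j < r" "i \<noteq> j"
  shows "coroot r i j \<in> cartan r"
proof -
  have "mtrace (coroot r i j) = (\<Sum>a<r. 1 * eps a (coroot r i j))"
    by (simp add: mtrace_def eps_def coroot_def)
  also have "\<dots> = 0" using sum_coroot[OF assms, of "\<lambda>_. 1"] by simp
  finally show ?thesis
    by (auto simp: cartan_def sl_def diagonal_mat_def coroot_def)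
qed

text \<open>On traceless diagonal matrices the coefficients of a linear form are determined up to a
  common additive constant, and equal totals force that constant to be zero.\<close>

lemma linear_form_eq_iff:
  fixes f g :: "nat \<Rightarrow> nat"
  assumes "1 \<le> r" and "(\<Sum>i<r. f i) = (\<Sum>i<r. g i)"
  shows "(\<forall>H\<in>cartan r. (\<Sum>i<r. of_nat (f i) * eps i H) = (\<Sum>i<r. of_nat (g i) * eps i H))
    \<longleftrightarrow> (\<forall>i<r. f i = g i)" (is "?L \<longleftrightarrow> ?R")
proof
  assume L: ?L
  define d where "d i = (of_nat (f i) - of_nat (g i) :: complex)" for i
  have const: "d i = d 0" if "i < r" for i
  proof (cases "i = 0")
    case False
    then have "0 < r" "i < r" "i \<noteq> 0" using that by auto
    then show ?thesis
      using bspec[OF L coroot_cartan[of i r 0]]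
      unfolding d_def sum_coroot[OF \<open>i < r\<close> \<open>0 < r\<close> \<open>i \<noteq> 0\<close>] by (simp add: algebra_simps)
  qed simp
  have "(\<Sum>i<r. d i) = (\<Sum>i<r. d 0)" by (rule sum.cong) (auto intro: const)
  then have eq: "(\<Sum>i<r. d i) = of_nat r * d 0" by simp
  have "(\<Sum>i<r. d i) = of_nat (\<Sum>i<r. f i) - of_nat (\<Sum>i<r. g i)"
    by (simp add: d_def sum_subtractf)
  then have "of_nat r * d 0 = 0" using eq assms(2) by simp
  then have "d 0 = 0" using assms(1) by simp
  show ?R
  proof (intro allI impI)
    fix i assume "i < r"
    then have "d i = 0" using const \<open>d 0 = 0\<close> by metis
    then show "f i = g i" by (simp add: d_def)
  qed
qed auto

text \<open>Scores and the entries of \<open>xs\<close> both add up to \<open>r choose 2\<close>, so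
  equality of the two weights is equality of all coefficients.\<close>

lemma NN_eq_card_tournaments:
  assumes "1 \<le> r" and xs: "xs \<in> Part (r choose 2) r"
  shows "NN r xs = card (tournaments r xs)"
proof -
  have s: "(\<Sum>i<r. xs ! i) = r choose 2"
    using xs by (auto simp: Part_def sum_list_sum_nth lessThan_atLeast0)
  have "(\<forall>H\<in>cartan r. spin_weight r A H = part_weight r xs H) \<longleftrightarrow> (\<forall>i<r. score r A i = xs ! i)"
    if A: "A \<subseteq> pos_roots r" for A
    using linear_form_eq_iff[OF assms(1), of "score r A" "(!) xs"] sum_score_all[OF A] s
    by (simp add: spin_weight_eq_score[OF A] part_weight_eq[OF assms(1)])
  then show ?thesis
    unfolding NN_def mult_spin_eq_card tournaments_def by (intro arg_cong[of _ _ card]) blast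
qed

section \<open>Splitting a tournament\<close>

text \<open>Relabelling that places a tournament on \<open>p\<close> players on the last
  \<open>p\<close> of \<open>m + p\<close> players.\<close>

definition shift :: "nat \<Rightarrow> nat \<times> nat \<Rightarrow> nat \<times> nat" where
  "shift m = (\<lambda>(i, j). (m + i, m + j))"

lemma inj_shift: "inj (shift m)"
  by (auto simp: inj_def shift_def)

lemma shift_mem_iff [simp]: "(m + i, m + j) \<in> shift m ` B \<longleftrightarrow> (i, j) \<in> B"
  by (auto simp: shift_def)

lemma pos_roots_add:
  "pos_roots (m + p) = pos_roots m \<union> shift m ` pos_roots p \<union> {..<m} \<times> {m..<m + p}"
proof -
  have "(i, j) \<in> shift m ` pos_roots p" if "m \<le> i" "i < j" "j < m + p" for i j
    using that shift_mem_iff[of m "i - m" "j - m" "pos_roots p"] by (auto simp: pos_roots_def)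
  then show ?thesis by (auto simp: pos_roots_def shift_def)
qed

context
  fixes m p :: nat and A B :: "(nat \<times> nat) set"
  assumes A: "A \<subseteq> pos_roots m" and B: "B \<subseteq> pos_roots p"
begin

text \<open>The combined set contains no cross pair, so each of the first \<open>m\<close> players
  gains \<open>p\<close> wins over the last \<open>p\<close> players, who gain nothing from these
  games.\<close>

lemma score_left:
  assumes i: "i < m"
  shows "score (m + p) (A \<union> shift m ` B) i = p + score m A i"
proof -
  have "{j. (i, j) \<in> pos_roots (m + p) - (A \<union> shift m ` B)} =
      {j. (i, j) \<in> pos_roots m - A} \<union> {m..<m + p}"
    using i A by (auto simp: pos_roots_def shift_def)
  moreover have "card \<dots> = card {j. (i, j) \<in> pos_roots m - A} + p"
    by (subst card_Un_disjoint) (auto simp: pos_roots_def)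
  moreover have "{j. (j, i) \<in> A \<union> shift m ` B} = {j. (j, i) \<in> A}"
    using i by (auto simp: shift_def)
  ultimately show ?thesis by (simp add: score_def)
qed

lemma score_right:
  assumes i: "i < p"
  shows "score (m + p) (A \<union> shift m ` B) (m + i) = score p B i"
proof -
  have 1: "{j. (m + i, j) \<in> pos_roots (m + p) - (A \<union> shift m ` B)} =
      (+) m ` {j. (i, j) \<in> pos_roots p - B}" (is "?X = ?Y")
  proof
    show "?X \<subseteq> ?Y"
    proof
      fix j assume j: "j \<in> ?X"
      then have "j = m + (j - m)" by (auto simp: pos_roots_def)
      then obtain k where "j = m + k" by blast
      then show "j \<in> ?Y" using j by (auto simp: pos_roots_def)
    qed
    show "?Y \<subseteq> ?X" using A by (auto simp: pos_roots_def shift_def)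
  qed
  have 2: "{j. (j, m + i) \<in> A \<union> shift m ` B} = (+) m ` {j. (j, i) \<in> B}" (is "?X = ?Y")
    using A by (auto simp: pos_roots_def shift_def image_iff)
  show ?thesis unfolding score_def 1 2 by (simp add: card_image)
qed

end

text \<open>The point is that every tournament with the long score sequence splits: the total of the
  first \<open>m\<close> scores leaves no room for a lost cross game.\<close>

lemma tournaments_append:
  assumes xs: "length xs = m" and ys: "length ys = p" and sum: "sum_list xs = m choose 2"
  shows "tournaments (m + p) (map ((+) p) xs @ ys) =
    (\<lambda>(A, B). A \<union> shift m ` B) ` (tournaments m xs \<times> tournaments p ys)"
proof (intro equalityI subsetI)
  fix C assume "C \<in> (\<lambda>(A, B). A \<union> shift m ` B) ` (tournaments m xs \<times> tournaments p ys)"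
  then obtain A B where C: "C = A \<union> shift m ` B"
    and A: "A \<subseteq> pos_roots m" "\<And>i. i < m \<Longrightarrow> score m A i = xs ! i"
    and B: "B \<subseteq> pos_roots p" "\<And>i. i < p \<Longrightarrow> score p B i = ys ! i"
    by (auto simp: tournaments_def)
  have "score (m + p) C i = (map ((+) p) xs @ ys) ! i" if "i < m + p" for i
  proof (cases "i < m")
    case True
    then show ?thesis using A B xs by (simp add: C score_left nth_append)
  next
    case False
    then show ?thesis
      using A B xs ys that score_right[OF A(1) B(1), of "i - m"] by (simp add: C nth_append)
  qed
  then show "C \<in> tournaments (m + p) (map ((+) p) xs @ ys)"
    using A(1) B(1) by (auto simp: C tournaments_def pos_roots_add)
next
  fix C assume "C \<in> tournaments (m + p) (map ((+) p) xs @ ys)"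
  then have C: "C \<subseteq> pos_roots (m + p)"
    and score: "\<And>i. i < m + p \<Longrightarrow> score (m + p) C i = (map ((+) p) xs @ ys) ! i"
    by (auto simp: tournaments_def)
  let ?cross = "{..<m} \<times> {m..<m + p}"
  have "(\<Sum>i<m. score (m + p) C i) = (\<Sum>i<m. p + xs ! i)"
    using xs by (intro sum.cong) (auto simp: score nth_append)
  also have "\<dots> = m * p + (m choose 2)"
    using sum xs by (simp add: sum.distrib sum_list_sum_nth lessThan_atLeast0)
  \<comment> \<open>By \<open>sum_score\<close> the same total is \<open>m choose 2\<close> plus the
    number of cross games won by the first group, so that number is \<open>m * p\<close>.\<close>
  finally have "card (?cross - C) = card ?cross"
    using sum_score[of m "m + p" C] C by simp
  then have "?cross - C = ?cross" by (intro card_subset_eq) auto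
  then have disj: "C \<inter> ?cross = {}" by blast
  define A B where "A = C \<inter> pos_roots m" and "B = shift m -` C \<inter> pos_roots p"
  have AB: "A \<subseteq> pos_roots m" "B \<subseteq> pos_roots p" by (auto simp: A_def B_def)
  have C_eq: "C = A \<union> shift m ` B"
    using C disj unfolding A_def B_def pos_roots_add by blast
  have "score m A i = xs ! i" if "i < m" for i
    using score_left[OF AB that] score[of i] that xs by (simp add: C_eq nth_append)
  moreover have "score p B i = ys ! i" if "i < p" for i
    using score_right[OF AB that] score[of "m + i"] that xs by (simp add: C_eq nth_append)
  ultimately show "C \<in> (\<lambda>(A, B). A \<union> shift m ` B) ` (tournaments m xs \<times> tournaments p ys)"
    using AB by (auto simp: C_eq tournaments_def)
qed

lemma card_tournaments_append:
  assumes "length xs = m" and "length ys = p" and "sum_list xs = m choose 2"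
  shows "card (tournaments (m + p) (map ((+) p) xs @ ys)) =
    card (tournaments m xs) * card (tournaments p ys)"
proof -
  have "inj_on (\<lambda>(A, B). A \<union> shift m ` B) (tournaments m xs \<times> tournaments p ys)"
  \<comment> \<open>Shifted pairs have both entries at least \<open>m\<close>, so intersecting with
    \<open>pos_roots m\<close> recovers \<open>A\<close>, and pulling back the rest recovers
    \<open>B\<close>.\<close>
  proof (rule inj_on_inverseI[where g = "\<lambda>C. (C \<inter> pos_roots m, shift m -` (C - pos_roots m))"])
    fix AB assume "AB \<in> tournaments m xs \<times> tournaments p ys"
    moreover obtain A B where AB: "AB = (A, B)" by fastforce
    ultimately have A: "A \<subseteq> pos_roots m" by (auto simp: tournaments_def)
    have "shift m ` B \<inter> pos_roots m = {}" by (auto simp: shift_def pos_roots_def)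
    then have "(A \<union> shift m ` B) \<inter> pos_roots m = A" "A \<union> shift m ` B - pos_roots m = shift m ` B"
      using A by auto
    then show "(\<lambda>C. (C \<inter> pos_roots m, shift m -` (C - pos_roots m)))
        ((\<lambda>(A, B). A \<union> shift m ` B) AB) = AB"
      by (simp add: AB inj_vimage_image_eq[OF inj_shift])
  qed
  then show ?thesis
    by (simp add: tournaments_append[OF assms] card_image card_cartesian_product)
qed

section \<open>Partitions\<close>

lemma sum_list_map_add: "sum_list (map ((+) (p::nat)) xs) = length xs * p + sum_list xs"
  by (induction xs) auto

text \<open>Only the junction of the two lists needs the bound on \<open>hd ys\<close>: the least
  entry of the first block is \<open>p + last xs\<close>, the greatest of the second is
  \<open>hd ys\<close>.\<close>

lemma append_in_Part:
  assumes "1 \<le> m" and "1 \<le> p"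
    and xs: "xs \<in> Part (m choose 2) m" and ys: "ys \<in> Part (p choose 2) p"
    and "hd ys \<le> p + last xs"
  shows "map ((+) p) xs @ ys \<in> Part ((m + p) choose 2) (m + p)"
proof -
  have sx: "sorted_wrt (\<ge>) xs" and sy: "sorted_wrt (\<ge>) ys" using xs ys by (auto simp: Part_def)
  have "last xs \<le> x" if "x \<in> set xs" for x
    using sx that by (cases xs rule: rev_cases) (auto simp: sorted_wrt_append)
  moreover have "y \<le> hd ys" if "y \<in> set ys" for y
    using sy that by (cases ys) auto
  ultimately have "y \<le> p + x" if "x \<in> set xs" "y \<in> set ys" for x y
    using that assms(5) by (meson add_left_mono order_trans)
  then show ?thesis
    using xs ys by (auto simp: Part_def sorted_wrt_append sorted_wrt_map sum_list_map_add choose_two_add)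
qed

lemma staircase_add:
  assumes "i \<le> m"
  shows "(\<Sum>k=1..i. m + p - k) = i * p + (\<Sum>k=1..i. m - k :: nat)"
proof -
  have "(\<Sum>k=1..i. m + p - k) = (\<Sum>k=1..i. p + (m - k))"
    using assms by (intro sum.cong) auto
  then show ?thesis by (simp add: sum.distrib)
qed

lemma staircase_full: "(\<Sum>k=1..m. m - k) = m choose 2"
proof (induction m)
  case (Suc m)
  \<comment> \<open>Passing from \<open>m\<close> to \<open>Suc m\<close> raises each of the first
    \<open>m\<close> terms by one; the new last term is zero.\<close>
  then show ?case using staircase_add[of m m 1] by (simp add: numeral_2_eq_2)
qed simp

text \<open>The first \<open>m\<close> terms give the constant, and the term at \<open>m + j\<close>
  is \<open>p - j\<close>. This also holds under truncated subtraction, so \<open>j\<close> needs no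
  upper bound.\<close>

lemma staircase_split:
  "(\<Sum>k=1..m + j. m + p - k) = m * p + (m choose 2) + (\<Sum>k=1..j. p - k)"
proof (induction j)
  case 0
  then show ?case using staircase_add[of m m p] staircase_full[of m] by simp
qed simp

text \<open>Each inequality for the long list is one for \<open>xs\<close> or \<open>ys\<close> with
  the same number added to both sides: \<open>i * p\<close> for a prefix of length
  \<open>i \<le> m\<close>, and \<open>m * p + (m choose 2)\<close> for one of length
  \<open>m + j\<close>.\<close>

lemma append_in_PP_iff:
  assumes xs: "xs \<in> Part (m choose 2) m" and ys: "ys \<in> Part (p choose 2) p"
    and app: "map ((+) p) xs @ ys \<in> Part ((m + p) choose 2) (m + p)" (is "?l \<in> _")
  shows "?l \<in> PP (m + p) \<longleftrightarrow> xs \<in> PP m \<and> ys \<in> PP p"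
proof -
  have len: "length xs = m" and sum: "sum_list xs = m choose 2" using xs by (auto simp: Part_def)
  let ?ok = "\<lambda>r zs i. sum_list (take i zs) \<le> (\<Sum>k=1..i. r - k)"
  have left: "?ok (m + p) ?l i \<longleftrightarrow> ?ok m xs i" if "i \<le> m" for i
    using that len by (simp add: take_map sum_list_map_add staircase_add del: One_nat_def)
  have right: "?ok (m + p) ?l (m + j) \<longleftrightarrow> ?ok p ys j" for j
    using len sum unfolding staircase_split by (simp add: sum_list_map_add)
  have "{1..m + p} = {1..m} \<union> (+) m ` {1..p}" by auto
  then have "(\<forall>i\<in>{1..m + p}. ?ok (m + p) ?l i) \<longleftrightarrow>
      (\<forall>i\<in>{1..m}. ?ok (m + p) ?l i) \<and> (\<forall>j\<in>{1..p}. ?ok (m + p) ?l (m + j))"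
    by (simp only: ball_Un ball_simps)
  then show ?thesis using xs ys app left right by (simp add: PP_def)
qed

theorem proposition4p13:
  fixes m p :: nat and \<mu> \<pi> :: "nat list"
  assumes "m \<ge> 1" and "p \<ge> 1"
    and "\<mu> \<in> Part (m choose 2) m"
    and "\<pi> \<in> Part (p choose 2) p"
    and "hd \<pi> \<le> p + last \<mu>"
  defines "n \<equiv> m + p"
    and "lam \<equiv> map (\<lambda>x. p + x) \<mu> @ \<pi>"
  shows "lam \<in> Part (n choose 2) n
    \<and> (lam \<in> PP n \<longleftrightarrow> \<mu> \<in> PP m \<and> \<pi> \<in> PP p)
    \<and> NN n lam = NN m \<mu> * NN p \<pi>"
proof -
  have lam: "lam \<in> Part (n choose 2) n"
    using append_in_Part[OF assms(1-5)] by (simp add: n_def lam_def)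
  moreover have "lam \<in> PP n \<longleftrightarrow> \<mu> \<in> PP m \<and> \<pi> \<in> PP p"
    using append_in_PP_iff[OF assms(3,4)] lam by (simp add: n_def lam_def)
  moreover have "card (tournaments n lam) = card (tournaments m \<mu>) * card (tournaments p \<pi>)"
    using card_tournaments_append[of \<mu> m \<pi> p] assms(3,4) by (simp add: Part_def n_def lam_def)
  then have "NN n lam = NN m \<mu> * NN p \<pi>"
    using lam assms(1-4) by (simp add: NN_eq_card_tournaments n_def)
  ultimately show ?thesis by blast
qed

end
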